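(* Each of the three operations $x+y$, $x\bmod y$ (with the convention $x\bmod 0=x$), and $2^x$ on $\mathbb{N}$ is the restriction to natural-number inputs of a log--exp term with principal values and constants.
   Context: $\mathbb{N}=\{0,1,2,\ldots\}$. For $y\ge1$, $x\bmod y=x-y\lfloor x/y\rfloor$. Principal values: for $z\in\mathbb{C}\setminus\{0\}$, $\operatorname{Log} z=\log|z|+i\operatorname{Arg} z$ with $\operatorname{Arg} z\in(-\pi,\pi]$. For $x\neq 0$, $x^y:=e^{y\operatorname{Log}x}$; for $a,b\ne0$ with $b\neq1$, $\log_b a:=\operatorname{Log}a/\operatorname{Log}b$. A log--exp term is a finite term built from the two binary operations $x^y$ and $\log_b a$, along with one or more variables and/or constants. It denotes a partial function: an input is outside its domain if any subterm asks for one of the excluded logarithms or bases. That an operation is the restriction of a term to natural-number inputs means the term is defined at all natural-number inputs and agrees there with the operation. *)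

theory Defs
  imports "HOL-Analysis.Complex_Transcendental"
begin

(* LLog b a stands for log_b a (base first); constants are arbitrary complex numbers. *)
datatype log_exp =
    LVar nat
  | LConst complex
  | LPow log_exp log_exp
  | LLog log_exp log_exp

primrec vars :: "log_exp \<Rightarrow> nat set" where
  "vars (LVar i) = {i}"
| "vars (LConst c) = {}"
| "vars (LPow s t) = vars s \<union> vars t"
| "vars (LLog s t) = vars s \<union> vars t"

(* For x \<noteq> 0, x powr y is exp (y * Ln x), where Ln is the principal branch with
   imaginary part in (-pi, pi]. The library values 0 powr y = 0 and Ln 0 = 0 are never
   used: excluded arguments give None. *)
definition cpow :: "complex \<Rightarrow> complex \<Rightarrow> complex option" where
  "cpow x y = (if x = 0 then None else Some (x powr y))"

definition clog :: "complex \<Rightarrow> complex \<Rightarrow> complex option" where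
  "clog b a = (if a = 0 \<or> b = 0 \<or> b = 1 then None else Some (Ln a / Ln b))"

primrec eval_term :: "(nat \<Rightarrow> complex) \<Rightarrow> log_exp \<Rightarrow> complex option" where
  "eval_term v (LVar i) = Some (v i)"
| "eval_term v (LConst c) = Some c"
| "eval_term v (LPow s t) =
     Option.bind (eval_term v s) (\<lambda>x. Option.bind (eval_term v t) (\<lambda>y. cpow x y))"
| "eval_term v (LLog s t) =
     Option.bind (eval_term v s) (\<lambda>b. Option.bind (eval_term v t) (\<lambda>a. clog b a))"

(* The n-ary operation f reads its arguments as v 0, ..., v (n - 1). *)
definition restriction_to_nat :: "nat \<Rightarrow> ((nat \<Rightarrow> nat) \<Rightarrow> nat) \<Rightarrow> log_exp \<Rightarrow> bool" where
  "restriction_to_nat n f t \<longleftrightarrow>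
     vars t \<subseteq> {..<n} \<and>
     (\<forall>v :: nat \<Rightarrow> nat. eval_term (\<lambda>i. of_nat (v i)) t = Some (of_nat (f v)))"

end

theory Submission
  imports Defs
begin

text \<open>
  On real values the positive base \<open>2\<close> makes every principal logarithm the real one, so
  \<open>log\<^sub>2 ((2\<^sup>x)\<^sup>y) = x y\<close> and, applying the same trick one exponential higher up,
  \<open>log\<^sub>2 (log\<^sub>2 ((2 ^ 2\<^sup>x) ^ 2\<^sup>y)) = log\<^sub>2 (2\<^sup>x 2\<^sup>y) = x + y\<close>. Both identities hold for all
  reals, and the arguments of the logarithms stay positive, so zero inputs cause no trouble.
  Multiplying by \<open>-1\<close> gives subtraction, and the power \<open>y\<^sup>-\<^sup>1\<close> gives division by \<open>y > 0\<close>.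

  The remainder comes from the branch cut. Since \<open>Ln (-1) = \<i> \<pi>\<close>, the number
  \<open>log\<^sub>-\<^sub>1 ((-1)\<^sup>u)\<close> is the representative of the real number \<open>u\<close> modulo \<open>2\<close> in \<open>(-1, 1]\<close>.
  The half-open interval is closed at the wrong end for a fractional part; taking
  \<open>u = 1 - 2 t\<close> reverses it, and \<open>(1 - log\<^sub>-\<^sub>1 ((-1)\<^sup>u)) / 2\<close> is the fractional part of \<open>t\<close>
  (lemma \<open>eval_frac_term\<close>). Hence \<open>x mod y = y frac (x / y)\<close> for \<open>y > 0\<close>.

  The term for \<open>x / y\<close> is undefined at \<open>y = 0\<close>, so the modulus must be changed to a positive
  one there. As \<open>1 mod (y + 1)\<close> is \<open>0\<close> for \<open>y = 0\<close> and \<open>1\<close> for \<open>y > 0\<close>, the modulus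
  \<open>y + (x + 1) (1 - 1 mod (y + 1))\<close> equals \<open>y\<close> for \<open>y > 0\<close> and \<open>x + 1\<close> for \<open>y = 0\<close>, and
  \<open>x mod (x + 1) = x\<close> is the value required by the convention.
\<close>

definition mult_term :: "log_exp \<Rightarrow> log_exp \<Rightarrow> log_exp" where
  "mult_term s t = LLog (LConst 2) (LPow (LPow (LConst 2) s) t)"

definition add_term :: "log_exp \<Rightarrow> log_exp \<Rightarrow> log_exp" where
  "add_term s t = LLog (LConst 2) (mult_term (LPow (LConst 2) s) (LPow (LConst 2) t))"

definition diff_term :: "log_exp \<Rightarrow> log_exp \<Rightarrow> log_exp" where
  "diff_term s t = add_term s (mult_term (LConst (-1)) t)"

definition divide_term :: "log_exp \<Rightarrow> log_exp \<Rightarrow> log_exp" where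
  "divide_term s t = mult_term s (LPow t (LConst (-1)))"

definition frac_term :: "log_exp \<Rightarrow> log_exp" where
  "frac_term t = divide_term
     (diff_term (LConst 1)
       (LLog (LConst (-1)) (LPow (LConst (-1)) (diff_term (LConst 1) (mult_term (LConst 2) t)))))
     (LConst 2)"

definition pos_mod_term :: "log_exp \<Rightarrow> log_exp \<Rightarrow> log_exp" where
  "pos_mod_term s t = mult_term t (frac_term (divide_term s t))"

definition mod_term :: "log_exp \<Rightarrow> log_exp \<Rightarrow> log_exp" where
  "mod_term s t = pos_mod_term s
     (add_term t
       (mult_term (add_term s (LConst 1))
         (diff_term (LConst 1) (pos_mod_term (LConst 1) (add_term t (LConst 1))))))"

lemmas term_defs = mult_term_def add_term_def diff_term_def divide_term_def frac_term_def
  pos_mod_term_def mod_term_def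

lemma eval_LConst_of_real:
  "c = complex_of_real a \<Longrightarrow> eval_term v (LConst c) = Some (of_real a)"
  by simp

lemma eval_LPow_of_real:
  assumes "eval_term v s = Some (of_real a)" and "eval_term v t = Some (of_real b)" and "a > 0"
  shows "eval_term v (LPow s t) = Some (of_real (a powr b))"
  using assms by (simp add: cpow_def powr_of_real)

lemma eval_LLog_of_real:
  assumes "eval_term v s = Some (of_real a)" and "eval_term v t = Some (of_real b)"
    and "a > 0" and "a \<noteq> 1" and "b > 0"
  shows "eval_term v (LLog s t) = Some (of_real (log a b))"
  using assms by (simp add: clog_def Ln_of_real log_def)

lemma eval_mult_term:
  assumes s: "eval_term v s = Some (of_real a)" and t: "eval_term v t = Some (of_real b)"
  shows "eval_term v (mult_term s t) = Some (of_real (a * b))"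
proof -
  have two: "eval_term v (LConst 2) = Some (of_real 2)"
    by (rule eval_LConst_of_real) simp
  have "eval_term v (mult_term s t) = Some (of_real (log 2 ((2 powr a) powr b)))"
    unfolding mult_term_def
    by (intro eval_LLog_of_real eval_LPow_of_real two s t) auto
  then show ?thesis
    by (simp add: powr_powr)
qed

lemma eval_add_term:
  assumes s: "eval_term v s = Some (of_real a)" and t: "eval_term v t = Some (of_real b)"
  shows "eval_term v (add_term s t) = Some (of_real (a + b))"
proof -
  have two: "eval_term v (LConst 2) = Some (of_real 2)"
    by (rule eval_LConst_of_real) simp
  have "eval_term v (add_term s t) = Some (of_real (log 2 (2 powr a * 2 powr b)))"
    unfolding add_term_def
    by (intro eval_LLog_of_real eval_mult_term eval_LPow_of_real two s t) auto
  then show ?thesis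
    by (simp flip: powr_add)
qed

lemma eval_diff_term:
  assumes s: "eval_term v s = Some (of_real a)" and t: "eval_term v t = Some (of_real b)"
  shows "eval_term v (diff_term s t) = Some (of_real (a - b))"
proof -
  have "eval_term v (diff_term s t) = Some (of_real (a + (-1) * b))"
    unfolding diff_term_def
    by (intro eval_add_term eval_mult_term s t eval_LConst_of_real) simp
  then show ?thesis
    by simp
qed

lemma eval_divide_term:
  assumes s: "eval_term v s = Some (of_real a)" and t: "eval_term v t = Some (of_real b)"
    and "b > 0"
  shows "eval_term v (divide_term s t) = Some (of_real (a / b))"
proof -
  have "eval_term v (divide_term s t) = Some (of_real (a * b powr (-1)))"
    unfolding divide_term_def
    by (intro eval_mult_term eval_LPow_of_real s t eval_LConst_of_real \<open>b > 0\<close>) simp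
  then show ?thesis
    using \<open>b > 0\<close> by (simp add: powr_minus_divide)
qed

text \<open>Shifting \<open>t\<close> by the integer \<open>\<lfloor>t\<rfloor>\<close> changes \<open>(1 - 2 t) \<i> \<pi>\<close> by a multiple of \<open>2 \<i> \<pi>\<close>, and
  the shifted exponent has imaginary part \<open>(1 - 2 frac t) \<pi> \<in> (-\<pi>, \<pi>]\<close>, where \<open>Ln\<close> inverts
  \<open>exp\<close>.\<close>

lemma Ln_minus_one_powr:
  "Ln ((-1) powr of_real (1 - 2 * t)) = of_real (1 - 2 * frac t) * (\<i> * of_real pi)"
proof -
  have "(-1) powr complex_of_real (1 - 2 * t) = exp (of_real (1 - 2 * t) * (\<i> * of_real pi))"
    by (simp add: powr_def)
  also have "of_real (1 - 2 * t) * (\<i> * of_real pi) =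
      of_real (1 - 2 * frac t) * (\<i> * of_real pi) +
      of_real (of_int (2 * (- \<lfloor>t\<rfloor>)) * pi) * \<i>"
    by (simp add: frac_def algebra_simps)
  also have "exp \<dots> = exp (of_real (1 - 2 * frac t) * (\<i> * of_real pi))"
    unfolding exp_eq by blast
  finally have *: "(-1) powr complex_of_real (1 - 2 * t) =
      exp (of_real (1 - 2 * frac t) * (\<i> * of_real pi))" .
  have "frac t * pi < 1 * pi" "0 \<le> frac t * pi"
    using frac_lt_1[of t] frac_ge_0[of t] pi_gt_zero by (auto intro: mult_strict_right_mono)
  then show ?thesis
    unfolding * by (intro Ln_exp) (auto simp: algebra_simps)
qed

lemma eval_frac_term:
  assumes t: "eval_term v t = Some (of_real a)"
  shows "eval_term v (frac_term t) = Some (of_real (frac a))"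
proof -
  have one: "eval_term v (LConst 1) = Some (of_real 1)"
    and two: "eval_term v (LConst 2) = Some (of_real 2)"
    by (rule eval_LConst_of_real; simp)+
  have u: "eval_term v (diff_term (LConst 1) (mult_term (LConst 2) t)) =
      Some (of_real (1 - 2 * a))"
    by (intro eval_diff_term eval_mult_term one two t)
  have "Ln ((-1) powr complex_of_real (1 - 2 * a)) / Ln (-1) = of_real (1 - 2 * frac a)"
    unfolding Ln_minus_one_powr by simp
  moreover have "(-1) powr complex_of_real (1 - 2 * a) \<noteq> 0"
    by (simp add: powr_def)
  ultimately have "eval_term v (LLog (LConst (-1))
      (LPow (LConst (-1)) (diff_term (LConst 1) (mult_term (LConst 2) t)))) =
      Some (of_real (1 - 2 * frac a))"
    using u by (simp add: cpow_def clog_def)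
  then have "eval_term v (frac_term t) = Some (of_real ((1 - (1 - 2 * frac a)) / 2))"
    unfolding frac_term_def by (intro eval_divide_term eval_diff_term one two) simp_all
  then show ?thesis
    by simp
qed

lemma eval_pos_mod_term:
  assumes s: "eval_term v s = Some (of_real (real m))"
    and t: "eval_term v t = Some (of_real (real n))"
    and "n > 0"
  shows "eval_term v (pos_mod_term s t) = Some (of_real (real (m mod n)))"
proof -
  have "real m = real n * real (m div n) + real (m mod n)"
    by (simp flip: of_nat_mult of_nat_add)
  moreover have "real n * frac (real m / real n) = real m - real n * real (m div n)"
    using \<open>n > 0\<close> by (simp add: frac_def floor_divide_of_nat_eq right_diff_distrib)
  ultimately have "real n * frac (real m / real n) = real (m mod n)"
    by linarith
  moreover have "eval_term v (pos_mod_term s t) =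
      Some (of_real (real n * frac (real m / real n)))"
    unfolding pos_mod_term_def
    using \<open>n > 0\<close> by (intro eval_mult_term eval_frac_term eval_divide_term s t) simp
  ultimately show ?thesis
    by simp
qed

lemma eval_mod_term:
  assumes s: "eval_term v s = Some (of_real (real m))"
    and t: "eval_term v t = Some (of_real (real n))"
  shows "eval_term v (mod_term s t) = Some (of_real (real (m mod n)))"
proof -
  define d where "d = (if n = 0 then m + 1 else n)"
  have one: "eval_term v (LConst 1) = Some (of_real (real 1))"
    by simp
  have "eval_term v (add_term t (LConst 1)) = Some (of_real (real (n + 1)))"
    using eval_add_term[OF t one] by simp
  then have "eval_term v (pos_mod_term (LConst 1) (add_term t (LConst 1))) =
      Some (of_real (real (1 mod (n + 1))))"
    by (intro eval_pos_mod_term one) simp_all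
  then have "eval_term v (add_term t (mult_term (add_term s (LConst 1))
      (diff_term (LConst 1) (pos_mod_term (LConst 1) (add_term t (LConst 1)))))) =
      Some (of_real (real n + (real m + real 1) * (real 1 - real (1 mod (n + 1)))))"
    by (intro eval_add_term eval_mult_term eval_diff_term s t one)
  also have "real n + (real m + real 1) * (real 1 - real (1 mod (n + 1))) = real d"
    by (simp add: d_def)
  finally have "eval_term v (mod_term s t) = Some (of_real (real (m mod d)))"
    unfolding mod_term_def by (intro eval_pos_mod_term s) (simp_all add: d_def)
  also have "m mod d = m mod n"
    by (simp add: d_def)
  finally show ?thesis .
qed

theorem propositionA1:
  shows "(\<exists>t. restriction_to_nat 2 (\<lambda>v. v 0 + v 1) t) \<and>
         (\<exists>t. restriction_to_nat 2 (\<lambda>v. if v 1 = 0 then v 0 else v 0 mod v 1) t) \<and>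
         (\<exists>t. restriction_to_nat 1 (\<lambda>v. 2 ^ v 0) t)"
proof (intro conjI exI)
  have var: "eval_term (\<lambda>i. of_nat (v i)) (LVar i) = Some (of_real (real (v i)))"
    for v :: "nat \<Rightarrow> nat" and i
    by simp
  show "restriction_to_nat 2 (\<lambda>v. v 0 + v 1) (add_term (LVar 0) (LVar 1))"
    unfolding restriction_to_nat_def
    using eval_add_term[OF var var] by (simp add: term_defs)
  show "restriction_to_nat 2 (\<lambda>v. if v 1 = 0 then v 0 else v 0 mod v 1)
      (mod_term (LVar 0) (LVar 1))"
    unfolding restriction_to_nat_def
  proof (intro conjI allI)
    show "vars (mod_term (LVar 0) (LVar 1)) \<subseteq> {..<2}"
      by (simp add: term_defs)
    show "eval_term (\<lambda>i. of_nat (v i)) (mod_term (LVar 0) (LVar 1)) =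
        Some (of_nat (if v 1 = 0 then v 0 else v 0 mod v 1))" for v :: "nat \<Rightarrow> nat"
      using eval_mod_term[OF var var, of v 0 1] by simp
  qed
  show "restriction_to_nat 1 (\<lambda>v. 2 ^ v 0) (LPow (LConst 2) (LVar 0))"
    by (simp add: restriction_to_nat_def cpow_def powr_nat')
qed

end
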